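(* Fix the initial weights $w_0$. For every $t \in \mathbb{N}$ (with $0\in\mathbb N$), both $\operatorname{var}\left(g_t^b \,\middle|\, \mathcal{F}_0 \right)$ and $\operatorname{var}\left(\nabla L\left(w_t^b\right) \,\middle|\, \mathcal{F}_0 \right)$ are decreasing functions of the mini-batch size $b$ for $b \in \{1,\dots,n\}$.
   Context: Mini-batch SGD for linear regression. Data $(x_1,y_1),\dots,(x_n,y_n)$ with $x_i\in\mathbb{R}^p$, $y_i\in\mathbb{R}$, $n\ge 2$. For $w\in\mathbb{R}^p$ let $L_i(w)=\frac12 (w^\top x_i-y_i)^2$ and $L(w)=\frac1n\sum_{i=1}^n L_i(w)$. Fix initial weights $w_0\in\mathbb{R}^p$ and learning rates $\alpha_t>0$, both independent of $b$. For mini-batch size $b\in[n]=\{1,\dots,n\}$, set $w_0^b=w_0$ and, for each $t\ge0$, sample $\mathcal{B}_t^b$ uniformly at random among subsets of $[n]$ of cardinality $b$, independently over iterations, and set $w_{t+1}^b=w_t^b-\alpha_t g_t^b$, where $g_t^b=\frac1b\sum_{i\in\mathcal{B}_t^b}\nabla L_i(w_t^b)$ is the stochastic gradient. $\mathcal{F}_0$ is the information consisting of $w_0$ only, so conditioning on $\mathcal{F}_0$ means that $w_0$ is fixed and the randomness comes from the mini-batches. For a random vector $Z$, $\operatorname{var}(Z\mid\mathcal{F}_0)=\mathbb{E}[\|Z\|^2\mid\mathcal{F}_0]-\|\mathbb{E}[Z\mid\mathcal{F}_0]\|^2$, a scalar, with $\|\cdot\|$ the Euclidean norm. "Decreasing"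 is in the non-strict sense (non-increasing). *)

theory Defs
  imports "HOL-Probability.Probability"
begin

definition grad :: "('a::real_inner \<Rightarrow> real) \<Rightarrow> 'a \<Rightarrow> 'a" where
  "grad f w = (THE D. GDERIV f w :> D)"

lemma grad_eqI:
  assumes "GDERIV f w :> D"
  shows "grad f w = D"
  unfolding grad_def
proof (rule the_equality)
  fix E assume "GDERIV f w :> E"
  then have "(\<lambda>h. h \<bullet> E) = (\<lambda>h. h \<bullet> D)"
    using assms unfolding gderiv_def by (rule has_derivative_unique)
  then have "h \<bullet> E = h \<bullet> D" for h
    by meson
  then show "E = D"
    by (metis vector_eq_ldot)
qed (rule assms)

definition sample_loss ::
    "(nat \<Rightarrow> real ^ 'p) \<Rightarrow> (nat \<Rightarrow> real) \<Rightarrow> nat \<Rightarrow> real ^ 'p \<Rightarrow> real" where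
  "sample_loss x y i w = (1 / 2) * (w \<bullet> x i - y i)\<^sup>2"

definition full_loss ::
    "nat \<Rightarrow> (nat \<Rightarrow> real ^ 'p) \<Rightarrow> (nat \<Rightarrow> real) \<Rightarrow> real ^ 'p \<Rightarrow> real" where
  "full_loss n x y w = (1 / real n) * (\<Sum>i = 1..n. sample_loss x y i w)"

definition batches :: "nat \<Rightarrow> nat \<Rightarrow> nat set set" where
  "batches n b = {S. S \<subseteq> {1..n} \<and> card S = b}"

definition batch_grad ::
    "(nat \<Rightarrow> real ^ 'p) \<Rightarrow> (nat \<Rightarrow> real) \<Rightarrow> nat \<Rightarrow> nat set \<Rightarrow> real ^ 'p \<Rightarrow> real ^ 'p" where
  "batch_grad x y b S w = (1 / real b) *\<^sub>R (\<Sum>i\<in>S. grad (sample_loss x y i) w)"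

text \<open>The weights after \<open>t\<close> steps along one realisation \<open>S 0, S 1, \<dots>\<close> of the mini-batches.\<close>

primrec sgd_weights ::
    "(nat \<Rightarrow> real ^ 'p) \<Rightarrow> (nat \<Rightarrow> real) \<Rightarrow> (nat \<Rightarrow> real) \<Rightarrow> real ^ 'p \<Rightarrow> nat \<Rightarrow>
      (nat \<Rightarrow> nat set) \<Rightarrow> nat \<Rightarrow> real ^ 'p" where
  "sgd_weights x y \<alpha> w0 b S 0 = w0"
| "sgd_weights x y \<alpha> w0 b S (Suc t) =
     sgd_weights x y \<alpha> w0 b S t - \<alpha> t *\<^sub>R batch_grad x y b (S t) (sgd_weights x y \<alpha> w0 b S t)"

definition sgd_gradient ::
    "(nat \<Rightarrow> real ^ 'p) \<Rightarrow> (nat \<Rightarrow> real) \<Rightarrow> (nat \<Rightarrow> real) \<Rightarrow> real ^ 'p \<Rightarrow> nat \<Rightarrow>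
      (nat \<Rightarrow> nat set) \<Rightarrow> nat \<Rightarrow> real ^ 'p" where
  "sgd_gradient x y \<alpha> w0 b S t = batch_grad x y b (S t) (sgd_weights x y \<alpha> w0 b S t)"

text \<open>The scalar variance of a random vector. Conditioning on the initial information amounts to
  keeping \<open>w0\<close> a fixed vector, so the variances given it are plain integrals over the sample
  space of the mini-batches.\<close>

definition vec_variance :: "'w measure \<Rightarrow> ('w \<Rightarrow> 'a::euclidean_space) \<Rightarrow> real" where
  "vec_variance M Z = (\<integral>\<omega>. (norm (Z \<omega>))\<^sup>2 \<partial>M) - (norm (\<integral>\<omega>. Z \<omega> \<partial>M))\<^sup>2"

text \<open>\<open>B t\<close> is the batch drawn at step \<open>t\<close>: uniform among the \<open>b\<close>-element subsets of
  \<open>{1..n}\<close>, independently over \<open>t\<close>. Measurability of each \<open>B t\<close> is part of \<open>indep_vars\<close>.\<close>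

definition uniform_batches ::
    "'w measure \<Rightarrow> nat \<Rightarrow> nat \<Rightarrow> (nat \<Rightarrow> 'w \<Rightarrow> nat set) \<Rightarrow> bool" where
  "uniform_batches M n b B \<longleftrightarrow>
     prob_space.indep_vars M (\<lambda>_. count_space (batches n b)) B UNIV \<and>
     (\<forall>t. distr M (count_space (batches n b)) (B t) = uniform_count_measure (batches n b))"

end

theory Submission
  imports Defs
begin

text \<open>
  The gradient of a batch of size \<open>b + 1\<close> is the average of the gradients of its \<open>b\<close>-element
  subsets, so by Jensen's inequality enlarging the batches decreases the expectation of every convex
  function of the batch gradient. The losses being quadratic, each step is an affine map of the
  weights, hence composing with it preserves convexity, and by induction on \<open>t\<close> the expectation of
  every convex function of \<open>w\<^sub>t\<close> decreases with \<open>b\<close>. The mean does not depend on \<open>b\<close>, because linear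
  functions and their negatives are both convex; taking the squared norm as the convex function gives
  the variances.
\<close>

section \<open>Averages over all batches of one size\<close>

definition batch_avg :: "nat \<Rightarrow> nat \<Rightarrow> (nat set \<Rightarrow> real) \<Rightarrow> real" where
  "batch_avg n b f = (\<Sum>S\<in>batches n b. f S) / real (card (batches n b))"

lemma finite_batches [simp]: "finite (batches n b)"
  by (rule finite_subset[of _ "Pow {1..n}"]) (auto simp: batches_def)

lemma finite_batch: "S \<in> batches n b \<Longrightarrow> finite S"
  by (auto simp: batches_def intro: finite_subset)

lemma batch_avg_mono:
  "(\<And>S. S \<in> batches n b \<Longrightarrow> f S \<le> g S) \<Longrightarrow> batch_avg n b f \<le> batch_avg n b g"
  unfolding batch_avg_def by (intro divide_right_mono sum_mono) auto

text \<open>Double counting: a (b+1)-batch with a marked element j corresponds to a b-batch together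
  with an element j outside it, and every b-batch has n - b elements outside.\<close>

lemma sum_batches_remove1:
  fixes f :: "nat set \<Rightarrow> real"
  shows "(\<Sum>S\<in>batches n (Suc b). \<Sum>j\<in>S. f (S - {j})) = real (n - b) * (\<Sum>S\<in>batches n b. f S)"
proof -
  have "(\<Sum>S\<in>batches n (Suc b). \<Sum>j\<in>S. f (S - {j}))
      = (\<Sum>(S, j)\<in>Sigma (batches n (Suc b)) (\<lambda>S. S). f (S - {j}))"
    by (intro sum.Sigma) (auto intro: finite_batch)
  also have "\<dots> = (\<Sum>(S, j)\<in>Sigma (batches n b) (\<lambda>S. {1..n} - S). f S)"
    by (rule sum.reindex_bij_witness[where
          i = "\<lambda>(S, j). (insert j S, j)" and j = "\<lambda>(S, j). (S - {j}, j)"])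
       (auto simp: batches_def insert_absorb card_insert_if finite_subset)
  also have "\<dots> = (\<Sum>S\<in>batches n b. \<Sum>j\<in>{1..n} - S. f S)"
    by (intro sum.Sigma[symmetric]) auto
  also have "\<dots> = (\<Sum>S\<in>batches n b. real (n - b) * f S)"
    by (intro sum.cong refl) (auto simp: batches_def card_Diff_subset finite_subset)
  finally show ?thesis
    by (simp add: sum_distrib_left)
qed

text \<open>Deleting a uniformly chosen element from a uniform (b+1)-batch leaves a uniform
  b-batch.\<close>

lemma batch_avg_remove1:
  assumes "b < n"
  shows "batch_avg n (Suc b) (\<lambda>S. (\<Sum>j\<in>S. f (S - {j})) / real (Suc b)) = batch_avg n b f"
proof -
  \<comment> \<open>Double counting with the constant function 1 relates the numbers of batches of
    sizes b and b + 1.\<close>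
  have "(\<Sum>S\<in>batches n (Suc b). \<Sum>j\<in>S. 1) = real (n - b) * real (card (batches n b))"
    using sum_batches_remove1[of "\<lambda>_. 1" n b] by simp
  moreover have "(\<Sum>S\<in>batches n (Suc b). \<Sum>j\<in>S. 1)
      = real (Suc b) * real (card (batches n (Suc b)))"
    by (simp add: batches_def)
  ultimately have card: "real (Suc b) * real (card (batches n (Suc b)))
      = real (n - b) * real (card (batches n b))"
    by simp
  have "batch_avg n (Suc b) (\<lambda>S. (\<Sum>j\<in>S. f (S - {j})) / real (Suc b))
      = (\<Sum>S\<in>batches n (Suc b). \<Sum>j\<in>S. f (S - {j}))
        / (real (Suc b) * real (card (batches n (Suc b))))"
    by (simp add: batch_avg_def flip: sum_divide_distrib)
  \<comment> \<open>The factor n - b occurs in numerator and denominator; it cancels because b < n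
    makes it nonzero.\<close>
  also have "\<dots> = batch_avg n b f"
    unfolding card sum_batches_remove1 using assms by (simp add: batch_avg_def)
  finally show ?thesis .
qed

text \<open>Each \<open>v i\<close> is missing from exactly one inner sum, the one with j =
  i.\<close>

lemma sum_remove1:
  fixes v :: "'i \<Rightarrow> 'a::real_vector"
  assumes "finite S"
  shows "(\<Sum>j\<in>S. \<Sum>i\<in>S - {j}. v i) = (real (card S) - 1) *\<^sub>R (\<Sum>i\<in>S. v i)"
proof -
  have "(\<Sum>j\<in>S. \<Sum>i\<in>S - {j}. v i) = (\<Sum>j\<in>S. (\<Sum>i\<in>S. v i) - v j)"
    using assms by (intro sum.cong refl) (simp add: sum_diff1)
  then show ?thesis
    by (simp add: sum_subtractf algebra_simps sum_constant_scaleR)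
qed

lemma batch_avg_convex_Suc:
  fixes v :: "nat \<Rightarrow> 'a::real_vector"
  assumes conv: "convex_on UNIV \<phi>" and b: "1 \<le> b" "b < n"
  shows "batch_avg n (Suc b) (\<lambda>S. \<phi> ((1 / real (Suc b)) *\<^sub>R (\<Sum>i\<in>S. v i)))
    \<le> batch_avg n b (\<lambda>S. \<phi> ((1 / real b) *\<^sub>R (\<Sum>i\<in>S. v i)))"
proof -
  have "\<phi> ((1 / real (Suc b)) *\<^sub>R (\<Sum>i\<in>S. v i))
      \<le> (\<Sum>j\<in>S. \<phi> ((1 / real b) *\<^sub>R (\<Sum>i\<in>S - {j}. v i))) / real (Suc b)"
    if "S \<in> batches n (Suc b)" for S
  proof -
    have S: "finite S" "card S = Suc b"
      using finite_batch[OF that] that by (simp_all add: batches_def)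
    then have "S \<noteq> {}"
      by auto
    \<comment> \<open>The batch mean is the equally weighted mean of the means over its b-element
      subsets: the factor card S - 1 = b from \<open>sum_remove1\<close> cancels 1/b, as b > 0.
      Jensen's inequality with weights 1/(b+1) then applies.\<close>
    have "(1 / real (Suc b)) *\<^sub>R (\<Sum>i\<in>S. v i)
        = (\<Sum>j\<in>S. (1 / real (Suc b)) *\<^sub>R ((1 / real b) *\<^sub>R (\<Sum>i\<in>S - {j}. v i)))"
      unfolding scaleR_sum_right[symmetric] sum_remove1[OF S(1)] using b S(2) by simp
    also have "\<phi> \<dots> \<le> (\<Sum>j\<in>S. (1 / real (Suc b)) * \<phi> ((1 / real b) *\<^sub>R (\<Sum>i\<in>S - {j}. v i)))"
      by (rule convex_on_sum[OF S(1) \<open>S \<noteq> {}\<close> conv]) (simp_all add: S)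
    finally show ?thesis
      by (simp add: sum_divide_distrib)
  qed
  then show ?thesis
    unfolding batch_avg_remove1[OF b(2), symmetric] by (rule batch_avg_mono)
qed

lemma batch_avg_convex_antimono:
  fixes v :: "nat \<Rightarrow> 'a::real_vector"
  assumes "convex_on UNIV \<phi>" "1 \<le> b" "b \<le> b'" "b' \<le> n"
  shows "batch_avg n b' (\<lambda>S. \<phi> ((1 / real b') *\<^sub>R (\<Sum>i\<in>S. v i)))
    \<le> batch_avg n b (\<lambda>S. \<phi> ((1 / real b) *\<^sub>R (\<Sum>i\<in>S. v i)))"
  using assms(3,4)
proof (induction b' rule: dec_induct)
  case (step k)
  then show ?case
    using order_trans[OF batch_avg_convex_Suc[OF assms(1), of k n v]] assms(2) by simp
qed simp

section \<open>Convex functions used for the comparison\<close>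

lemma convex_on_compose_affine:
  fixes f :: "'a::real_vector \<Rightarrow> 'b::real_vector"
  assumes "convex_on UNIV \<phi>"
    and "\<And>u v a b. u + v = 1 \<Longrightarrow> f (u *\<^sub>R a + v *\<^sub>R b) = u *\<^sub>R f a + v *\<^sub>R f b"
  shows "convex_on UNIV (\<lambda>w. \<phi> (f w))"
  using assms by (auto simp: convex_on_def)

lemma convex_on_norm_power2:
  "convex_on UNIV (\<lambda>z::'a::real_inner. (norm z)\<^sup>2)"
proof (rule convex_onI)
  fix t :: real and a b :: 'a
  assume t: "0 < t" "t < 1"
  have "(1 - t) * (norm a)\<^sup>2 + t * (norm b)\<^sup>2 - (norm ((1 - t) *\<^sub>R a + t *\<^sub>R b))\<^sup>2
      = t * (1 - t) * (norm (a - b))\<^sup>2"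
    unfolding power2_norm_eq_inner by (simp add: inner_simps inner_commute[of b a] algebra_simps)
  moreover have "0 \<le> t * (1 - t) * (norm (a - b))\<^sup>2"
    using t by simp
  ultimately show "(norm ((1 - t) *\<^sub>R a + t *\<^sub>R b))\<^sup>2 \<le> (1 - t) * (norm a)\<^sup>2 + t * (norm b)\<^sup>2"
    by linarith
qed simp

lemma convex_on_inner: "convex_on UNIV (\<lambda>z::'a::real_inner. z \<bullet> e)"
  by (rule convex_onI) (simp_all add: inner_simps)

lemma convex_on_batch_avg:
  fixes f :: "nat set \<Rightarrow> 'a::real_vector \<Rightarrow> real"
  assumes "\<And>S. convex_on UNIV (f S)"
  shows "convex_on UNIV (\<lambda>w. batch_avg n b (\<lambda>S. f S w))"
proof -
  have "convex_on UNIV (\<lambda>w. \<Sum>S\<in>A. f S w)" for A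
    by (induction A rule: infinite_finite_induct)
       (auto simp: convex_on_const intro: convex_on_add assms)
  then show ?thesis
    unfolding batch_avg_def by (intro convex_on_cdiv) auto
qed

section \<open>Gradients as affine functions of the weights\<close>

lemma GDERIV_sample_loss: "GDERIV (sample_loss x y i) w :> (w \<bullet> x i - y i) *\<^sub>R x i"
  unfolding gderiv_def sample_loss_def
  by (rule derivative_eq_intros refl | simp add: fun_eq_iff algebra_simps)+

lemma grad_sample_loss: "grad (sample_loss x y i) w = (w \<bullet> x i - y i) *\<^sub>R x i"
  by (rule grad_eqI) (rule GDERIV_sample_loss)

text \<open>Treating the full gradient as the gradient of the single batch \<open>{1..n}\<close>
  lets \<open>batch_grad_affine\<close> cover both gradients.\<close>

lemma grad_full_loss: "grad (full_loss n x y) w = batch_grad x y n {1..n} w"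
proof (rule grad_eqI)
  show "GDERIV (full_loss n x y) w :> batch_grad x y n {1..n} w"
    unfolding gderiv_def full_loss_def batch_grad_def grad_sample_loss
    by (rule derivative_eq_intros GDERIV_sample_loss[unfolded gderiv_def] refl
        | simp add: inner_sum_right)+
qed

lemma batch_grad_affine:
  assumes "u + v = 1"
  shows "batch_grad x y b S (u *\<^sub>R w + v *\<^sub>R w')
    = u *\<^sub>R batch_grad x y b S w + v *\<^sub>R batch_grad x y b S w'"
proof -
  have "(u *\<^sub>R w + v *\<^sub>R w') \<bullet> x i - y i = u * (w \<bullet> x i - y i) + v * (w' \<bullet> x i - y i)" for i
  proof -
    \<comment> \<open>The constant term of the residual is split in the proportions u and v; this is
      where the map is affine rather than linear.\<close>
    have "y i = (u + v) * y i"
      using assms by simp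
    then show ?thesis
      by (simp add: inner_simps algebra_simps)
  qed
  then show ?thesis
    by (simp add: batch_grad_def grad_sample_loss sum.distrib scaleR_sum_right scaleR_add_left
        scaleR_add_right mult.commute mult.left_commute)
qed

text \<open>The weights at step t see only the batches drawn before t; with independence over the
  steps, this separates them from the batch drawn at t.\<close>

lemma sgd_weights_cong:
  "(\<And>s. s < t \<Longrightarrow> S s = S' s) \<Longrightarrow> sgd_weights x y \<alpha> w0 b S t = sgd_weights x y \<alpha> w0 b S' t"
  by (induction t) auto

section \<open>Random batches and integrating out the next one\<close>

context prob_space
begin

lemma
  assumes "uniform_batches M n b B"
  shows uniform_batches_measurable: "B t \<in> M \<rightarrow>\<^sub>M count_space (batches n b)"
    and uniform_batches_indep: "indep_vars (\<lambda>_. count_space (batches n b)) B UNIV"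
  using assms by (auto simp: uniform_batches_def indep_vars_def)

lemma uniform_batches_in: "uniform_batches M n b B \<Longrightarrow> \<omega> \<in> space M \<Longrightarrow> B t \<omega> \<in> batches n b"
  using measurable_space[OF uniform_batches_measurable] by fastforce

text \<open>The point probability is written as the expectation of an indicator, the factor that
  splits off in \<open>expectation_next_batch\<close>.\<close>

lemma uniform_batches_prob:
  assumes "uniform_batches M n b B" "S \<in> batches n b"
  shows "(\<integral>\<omega>. indicator {S} (B t \<omega>) \<partial>M) = 1 / real (card (batches n b))"
proof -
  have "1 / real (card (batches n b)) = measure (uniform_count_measure (batches n b)) {S}"
    using assms(2) by (simp add: measure_uniform_count_measure)
  also have "\<dots> = measure (distr M (count_space (batches n b)) (B t)) {S}"
    using assms(1) by (simp add: uniform_batches_def)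
  also have "\<dots> = prob (B t -` {S} \<inter> space M)"
    using assms uniform_batches_measurable by (intro measure_distr) auto
  also have "\<dots> = (\<integral>\<omega>. indicator (B t -` {S} \<inter> space M) \<omega> \<partial>M)"
    by simp
  also have "\<dots> = (\<integral>\<omega>. indicator {S} (B t \<omega>) \<partial>M)"
    by (intro Bochner_Integration.integral_cong) (auto simp: indicator_def)
  finally show ?thesis by simp
qed

text \<open>The first t batches take only finitely many joint values, so any function of them is
  bounded. It is also measurable without further assumptions, since a finite product of these finite
  count spaces is again a count space.\<close>

lemma integrable_prefix:
  fixes g :: "(nat \<Rightarrow> nat set) \<Rightarrow> 'b::{banach, second_countable_topology}"
  assumes B: "uniform_batches M n b B"
    and g: "\<And>S S'. (\<And>s. s < t \<Longrightarrow> S s = S' s) \<Longrightarrow> g S = g S'"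
  shows "integrable M (\<lambda>\<omega>. g (\<lambda>s. B s \<omega>))"
proof -
  let ?R = "\<lambda>\<omega>. restrict (\<lambda>s. B s \<omega>) {..<t}"
  let ?P = "PiE {..<t} (\<lambda>_. batches n b)"
  have "?R \<in> M \<rightarrow>\<^sub>M PiM {..<t} (\<lambda>_. count_space (batches n b))"
    by (intro measurable_restrict uniform_batches_measurable[OF B])
  then have R: "?R \<in> M \<rightarrow>\<^sub>M count_space ?P"
    by (simp add: count_space_PiM_finite countable_finite)
  have fin: "finite ?P"
    by (intro finite_PiE) auto
  have "integrable M (\<lambda>\<omega>. g (?R \<omega>))"
  proof (rule integrable_const_bound)
    show "AE \<omega> in M. norm (g (?R \<omega>)) \<le> Max ((\<lambda>S. norm (g S)) ` ?P)"
      using measurable_space[OF R] fin by (intro AE_I2 Max_ge) auto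
    show "(\<lambda>\<omega>. g (?R \<omega>)) \<in> borel_measurable M"
      by (rule measurable_compose[OF R]) simp
  qed
  moreover have "g (?R \<omega>) = g (\<lambda>s. B s \<omega>)" for \<omega>
    by (rule g) simp
  ultimately show ?thesis by simp
qed

text \<open>Conditioning on the past: \<open>B t\<close> is independent of the earlier batches, so
  it can be replaced by an average over its values. Splitting by the value T of \<open>B t\<close>
  gives products of an indicator and a function of the past, whose expectations factor.\<close>

lemma expectation_next_batch:
  fixes f :: "nat set \<Rightarrow> (nat \<Rightarrow> nat set) \<Rightarrow> real"
  assumes B: "uniform_batches M n b B"
    and f: "\<And>T S S'. (\<And>s. s < t \<Longrightarrow> S s = S' s) \<Longrightarrow> f T S = f T S'"
  shows "(\<integral>\<omega>. f (B t \<omega>) (\<lambda>s. B s \<omega>) \<partial>M)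
    = (\<integral>\<omega>. batch_avg n b (\<lambda>T. f T (\<lambda>s. B s \<omega>)) \<partial>M)"
proof -
  let ?C = "count_space (batches n b)"
  let ?R = "\<lambda>A \<omega>. restrict (\<lambda>s. B s \<omega>) A"
  have int_f: "integrable M (\<lambda>\<omega>. f T (\<lambda>s. B s \<omega>))" for T
    using B by (rule integrable_prefix) (rule f)
  \<comment> \<open>The indicator looks at the batch of step t itself, hence a prefix of length
    \<open>Suc t\<close>.\<close>
  have int_ind: "integrable M (\<lambda>\<omega>. indicator {T} (B t \<omega>) :: real)" for T
    using B by (rule integrable_prefix[where t = "Suc t" and g = "\<lambda>S. indicator {T} (S t)"]) simp
  have indep: "indep_var borel (\<lambda>\<omega>. indicator {T} (B t \<omega>) :: real)
      borel (\<lambda>\<omega>. f T (\<lambda>s. B s \<omega>))" for T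
  proof -
    \<comment> \<open>The index sets \<open>{t}\<close> and \<open>{..<t}\<close> are disjoint, so
      the two restricted families are independent.\<close>
    have "indep_var (PiM {t} (\<lambda>_. ?C)) (?R {t}) (PiM {..<t} (\<lambda>_. ?C)) (?R {..<t})"
      by (rule indep_var_restrict[OF uniform_batches_indep[OF B]]) auto
    then have "indep_var borel ((\<lambda>S. indicator {T} (S t) :: real) \<circ> ?R {t})
        borel (f T \<circ> ?R {..<t})"
      by (rule indep_var_compose) (simp_all add: count_space_PiM_finite countable_finite)
    moreover have "f T (?R {..<t} \<omega>) = f T (\<lambda>s. B s \<omega>)" for \<omega>
      by (rule f) simp
    ultimately show ?thesis
      by (simp add: o_def)
  qed
  have "(\<integral>\<omega>. f (B t \<omega>) (\<lambda>s. B s \<omega>) \<partial>M)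
      = (\<integral>\<omega>. (\<Sum>T\<in>batches n b. indicator {T} (B t \<omega>) * f T (\<lambda>s. B s \<omega>)) \<partial>M)"
  proof (intro Bochner_Integration.integral_cong refl)
    fix \<omega> assume "\<omega> \<in> space M"
    then have "B t \<omega> \<in> batches n b"
      by (rule uniform_batches_in[OF B])
    then show "f (B t \<omega>) (\<lambda>s. B s \<omega>)
        = (\<Sum>T\<in>batches n b. indicator {T} (B t \<omega>) * f T (\<lambda>s. B s \<omega>))"
      by (simp add: indicator_def if_distrib[of "\<lambda>c. c * _"] sum.delta cong: if_cong)
  qed
  also have "\<dots> = (\<Sum>T\<in>batches n b. \<integral>\<omega>. indicator {T} (B t \<omega>) * f T (\<lambda>s. B s \<omega>) \<partial>M)"
    by (intro Bochner_Integration.integral_sum indep_var_integrable indep int_ind int_f)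
  also have "\<dots> = (\<Sum>T\<in>batches n b.
      1 / real (card (batches n b)) * (\<integral>\<omega>. f T (\<lambda>s. B s \<omega>) \<partial>M))"
    by (intro sum.cong refl)
       (simp add: indep_var_lebesgue_integral[OF indep int_ind int_f] uniform_batches_prob[OF B])
  also have "\<dots> = (\<integral>\<omega>. batch_avg n b (\<lambda>T. f T (\<lambda>s. B s \<omega>)) \<partial>M)"
    by (simp add: batch_avg_def int_f sum_divide_distrib)
  finally show ?thesis .
qed

section \<open>Comparing expectations for two batch sizes\<close>

lemma integrable_sgd_weights:
  fixes h :: "real ^ 'p \<Rightarrow> 'b::{banach, second_countable_topology}"
  assumes "uniform_batches M n b B"
  shows "integrable M (\<lambda>\<omega>. h (sgd_weights x y \<alpha> w0 b (\<lambda>s. B s \<omega>) t))"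
  by (rule integrable_prefix[OF assms, where t = t and g = "\<lambda>S. h (sgd_weights x y \<alpha> w0 b S t)"])
     (intro arg_cong[where f = h] sgd_weights_cong)

lemma integrable_sgd_gradient:
  fixes h :: "real ^ 'p \<Rightarrow> 'b::{banach, second_countable_topology}"
  assumes "uniform_batches M n b B"
  shows "integrable M (\<lambda>\<omega>. h (sgd_gradient x y \<alpha> w0 b (\<lambda>s. B s \<omega>) t))"
proof (rule integrable_prefix[OF assms, where
      t = "Suc t" and g = "\<lambda>S. h (sgd_gradient x y \<alpha> w0 b S t)"])
  fix S S' :: "nat \<Rightarrow> nat set"
  assume "\<And>s. s < Suc t \<Longrightarrow> S s = S' s"
  then have "S t = S' t" "sgd_weights x y \<alpha> w0 b S t = sgd_weights x y \<alpha> w0 b S' t"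
    by (auto intro: sgd_weights_cong)
  then show "h (sgd_gradient x y \<alpha> w0 b S t) = h (sgd_gradient x y \<alpha> w0 b S' t)"
    by (simp add: sgd_gradient_def)
qed

text \<open>One step in a form serving two purposes:
  \<open>\<phi> w g = h (w - \<alpha> t *\<^sub>R g)\<close> yields the next weights, and
  \<open>\<phi> w = h\<close> yields the stochastic gradient. Convexity along \<open>w\<close>
  allows the comparison of weights to be applied, and convexity in \<open>g\<close> allows the
  comparison of batch averages.\<close>

lemma expectation_convex_step:
  fixes w0 :: "real ^ 'p"
  assumes B: "uniform_batches M n b B" and B': "uniform_batches M n b' B'"
    and b: "1 \<le> b" "b \<le> b'" "b' \<le> n"
    and weights: "\<And>h. convex_on UNIV h \<Longrightarrow>
      (\<integral>\<omega>. h (sgd_weights x y \<alpha> w0 b' (\<lambda>s. B' s \<omega>) t) \<partial>M)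
      \<le> (\<integral>\<omega>. h (sgd_weights x y \<alpha> w0 b (\<lambda>s. B s \<omega>) t) \<partial>M)"
    and \<phi>: "\<And>S c. convex_on UNIV (\<lambda>w. \<phi> w (batch_grad x y c S w))"
    and \<phi>_grad: "\<And>w. convex_on UNIV (\<phi> w)"
  shows "(\<integral>\<omega>. \<phi> (sgd_weights x y \<alpha> w0 b' (\<lambda>s. B' s \<omega>) t)
        (sgd_gradient x y \<alpha> w0 b' (\<lambda>s. B' s \<omega>) t) \<partial>M)
    \<le> (\<integral>\<omega>. \<phi> (sgd_weights x y \<alpha> w0 b (\<lambda>s. B s \<omega>) t)
        (sgd_gradient x y \<alpha> w0 b (\<lambda>s. B s \<omega>) t) \<partial>M)"
proof -
  define A where "A c w = batch_avg n c (\<lambda>S. \<phi> w (batch_grad x y c S w))" for c w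
  have avg: "(\<integral>\<omega>. \<phi> (sgd_weights x y \<alpha> w0 c (\<lambda>s. D s \<omega>) t)
        (sgd_gradient x y \<alpha> w0 c (\<lambda>s. D s \<omega>) t) \<partial>M)
      = (\<integral>\<omega>. A c (sgd_weights x y \<alpha> w0 c (\<lambda>s. D s \<omega>) t) \<partial>M)"
    if "uniform_batches M n c D" for c D
    unfolding A_def sgd_gradient_def
    by (rule expectation_next_batch[OF that, where
          f = "\<lambda>T S. \<phi> (sgd_weights x y \<alpha> w0 c S t) (batch_grad x y c T (sgd_weights x y \<alpha> w0 c S t))"])
       (metis sgd_weights_cong)
  \<comment> \<open>First only the law of the weights changes, the averaged function
    \<open>A b'\<close> being convex.\<close>
  have "(\<integral>\<omega>. A b' (sgd_weights x y \<alpha> w0 b' (\<lambda>s. B' s \<omega>) t) \<partial>M)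
      \<le> (\<integral>\<omega>. A b' (sgd_weights x y \<alpha> w0 b (\<lambda>s. B s \<omega>) t) \<partial>M)"
    unfolding A_def by (intro weights convex_on_batch_avg \<phi>)
  \<comment> \<open>Then the size of the current batch changes, pointwise at fixed weights.\<close>
  also have "\<dots> \<le> (\<integral>\<omega>. A b (sgd_weights x y \<alpha> w0 b (\<lambda>s. B s \<omega>) t) \<partial>M)"
  proof (intro integral_mono integrable_sgd_weights[OF B])
    show "A b' w \<le> A b w" for w
      unfolding A_def batch_grad_def by (rule batch_avg_convex_antimono[OF \<phi>_grad b])
  qed
  finally show ?thesis
    by (simp only: avg[OF B] avg[OF B'])
qed

lemma expectation_convex_sgd_weights:
  fixes w0 :: "real ^ 'p"
  assumes B: "uniform_batches M n b B" and B': "uniform_batches M n b' B'"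
    and b: "1 \<le> b" "b \<le> b'" "b' \<le> n"
    and "convex_on UNIV h"
  shows "(\<integral>\<omega>. h (sgd_weights x y \<alpha> w0 b' (\<lambda>s. B' s \<omega>) t) \<partial>M)
      \<le> (\<integral>\<omega>. h (sgd_weights x y \<alpha> w0 b (\<lambda>s. B s \<omega>) t) \<partial>M)"
  using \<open>convex_on UNIV h\<close>
proof (induction t arbitrary: h)
  case (Suc t)
  have step: "(u *\<^sub>R w + v *\<^sub>R w') - c *\<^sub>R (u *\<^sub>R g + v *\<^sub>R g')
      = u *\<^sub>R (w - c *\<^sub>R g) + v *\<^sub>R (w' - c *\<^sub>R g')"
    for u v c :: real and w w' g g' :: "real ^ 'p"
    by (simp add: scaleR_diff_right scaleR_add_right mult.commute)
  have conv: "convex_on UNIV (\<lambda>w. h (w - \<alpha> t *\<^sub>R batch_grad x y c S w))" for c S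
    by (rule convex_on_compose_affine[OF Suc.prems]) (simp only: batch_grad_affine step)
  have conv_grad: "convex_on UNIV (\<lambda>g. h (w - \<alpha> t *\<^sub>R g))" for w
  proof (rule convex_on_compose_affine[OF Suc.prems])
    fix u v :: real and g g' :: "real ^ 'p"
    assume "u + v = 1"
    \<comment> \<open>With the weights fixed, \<open>w\<close> is itself a combination of two copies
      of \<open>w\<close>, so \<open>step\<close> applies with \<open>w' = w\<close>.\<close>
    then have "u *\<^sub>R w + v *\<^sub>R w = w"
      by (simp flip: scaleR_add_left)
    then show "w - \<alpha> t *\<^sub>R (u *\<^sub>R g + v *\<^sub>R g')
        = u *\<^sub>R (w - \<alpha> t *\<^sub>R g) + v *\<^sub>R (w - \<alpha> t *\<^sub>R g')"
      using step[of u w v w] by simp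
  qed
  have "(\<integral>\<omega>. h (sgd_weights x y \<alpha> w0 b' (\<lambda>s. B' s \<omega>) t
        - \<alpha> t *\<^sub>R sgd_gradient x y \<alpha> w0 b' (\<lambda>s. B' s \<omega>) t) \<partial>M)
      \<le> (\<integral>\<omega>. h (sgd_weights x y \<alpha> w0 b (\<lambda>s. B s \<omega>) t
        - \<alpha> t *\<^sub>R sgd_gradient x y \<alpha> w0 b (\<lambda>s. B s \<omega>) t) \<partial>M)"
    by (rule expectation_convex_step[OF B B' b, where \<phi> = "\<lambda>w g. h (w - \<alpha> t *\<^sub>R g)"])
       (fact Suc.IH conv conv_grad)+
  then show ?case
    by (simp add: sgd_gradient_def)
qed simp

lemma expectation_convex_sgd_gradient:
  fixes w0 :: "real ^ 'p"
  assumes B: "uniform_batches M n b B" and B': "uniform_batches M n b' B'"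
    and b: "1 \<le> b" "b \<le> b'" "b' \<le> n"
    and h: "convex_on UNIV h"
  shows "(\<integral>\<omega>. h (sgd_gradient x y \<alpha> w0 b' (\<lambda>s. B' s \<omega>) t) \<partial>M)
      \<le> (\<integral>\<omega>. h (sgd_gradient x y \<alpha> w0 b (\<lambda>s. B s \<omega>) t) \<partial>M)"
proof (rule expectation_convex_step[OF B B' b, where \<phi> = "\<lambda>w. h"])
  show "convex_on UNIV (\<lambda>w. h (batch_grad x y c S w))" for S c
    by (rule convex_on_compose_affine[OF h]) (rule batch_grad_affine)
qed (fact expectation_convex_sgd_weights[OF B B' b] h)+

text \<open>The full gradient is the same affine function of the weights for both batch sizes, so
  comparing the weights suffices and no further batch is averaged.\<close>

lemma expectation_convex_grad_full_loss:
  fixes w0 :: "real ^ 'p"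
  assumes B: "uniform_batches M n b B" and B': "uniform_batches M n b' B'"
    and b: "1 \<le> b" "b \<le> b'" "b' \<le> n"
    and h: "convex_on UNIV h"
  shows "(\<integral>\<omega>. h (grad (full_loss n x y) (sgd_weights x y \<alpha> w0 b' (\<lambda>s. B' s \<omega>) t)) \<partial>M)
      \<le> (\<integral>\<omega>. h (grad (full_loss n x y) (sgd_weights x y \<alpha> w0 b (\<lambda>s. B s \<omega>) t)) \<partial>M)"
  unfolding grad_full_loss
  by (rule expectation_convex_sgd_weights[OF B B' b, where h = "\<lambda>w. h (batch_grad x y n {1..n} w)"])
     (intro convex_on_compose_affine[OF h] batch_grad_affine)

end

section \<open>From expectations of convex functions to variances\<close>

lemma vec_variance_mono:
  fixes X Y :: "'w \<Rightarrow> 'a::euclidean_space"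
  assumes "integrable M X" "integrable M Y"
    and le: "\<And>h::'a \<Rightarrow> real. convex_on UNIV h \<Longrightarrow> (\<integral>\<omega>. h (X \<omega>) \<partial>M) \<le> (\<integral>\<omega>. h (Y \<omega>) \<partial>M)"
  shows "vec_variance M X \<le> vec_variance M Y"
proof -
  have inner_le: "(\<integral>\<omega>. X \<omega> \<partial>M) \<bullet> e \<le> (\<integral>\<omega>. Y \<omega> \<partial>M) \<bullet> e" for e
    using le[OF convex_on_inner, of e]
    by (simp only: integral_inner_left[OF assms(1)] integral_inner_left[OF assms(2)])
  \<comment> \<open>The inequality for \<open>e\<close> and for \<open>- e\<close> forces equality,
    so the means agree and the variances differ only in the expected squared norms.\<close>
  have "(\<integral>\<omega>. X \<omega> \<partial>M) \<bullet> e = (\<integral>\<omega>. Y \<omega> \<partial>M) \<bullet> e" for e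
  proof (rule order_antisym)
    show "(\<integral>\<omega>. Y \<omega> \<partial>M) \<bullet> e \<le> (\<integral>\<omega>. X \<omega> \<partial>M) \<bullet> e"
      using inner_le[of "- e"] by (simp only: inner_minus_right neg_le_iff_le)
  qed (rule inner_le)
  then have "(\<integral>\<omega>. X \<omega> \<partial>M) = (\<integral>\<omega>. Y \<omega> \<partial>M)"
    by (rule euclidean_eqI)
  then show ?thesis
    unfolding vec_variance_def using le[OF convex_on_norm_power2] by simp
qed

theorem corollary1:
  fixes x :: "nat \<Rightarrow> real ^ 'p" and y :: "nat \<Rightarrow> real" and n :: nat
    and w0 :: "real ^ 'p" and \<alpha> :: "nat \<Rightarrow> real"
    and M :: "'w measure" and B :: "nat \<Rightarrow> nat \<Rightarrow> 'w \<Rightarrow> nat set"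
  assumes "n \<ge> 2"
    and "\<And>t. \<alpha> t > 0"
    and "prob_space M"
    and "\<And>b. b \<in> {1..n} \<Longrightarrow> uniform_batches M n b (B b)"
  shows "\<forall>t.
    antimono_on {1..n}
      (\<lambda>b. vec_variance M (\<lambda>\<omega>. sgd_gradient x y \<alpha> w0 b (\<lambda>s. B b s \<omega>) t)) \<and>
    antimono_on {1..n}
      (\<lambda>b. vec_variance M
        (\<lambda>\<omega>. grad (full_loss n x y) (sgd_weights x y \<alpha> w0 b (\<lambda>s. B b s \<omega>) t)))"
proof (intro allI conjI monotone_onI)
  interpret prob_space M by fact
  fix t b b'
  assume *: "b \<in> {1..n}" "b' \<in> {1..n}" "b \<le> b'"
  then have b: "1 \<le> b" "b \<le> b'" "b' \<le> n"
    by auto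
  note B = assms(4)[OF *(1)] and B' = assms(4)[OF *(2)]
  show "vec_variance M (\<lambda>\<omega>. sgd_gradient x y \<alpha> w0 b' (\<lambda>s. B b' s \<omega>) t)
      \<le> vec_variance M (\<lambda>\<omega>. sgd_gradient x y \<alpha> w0 b (\<lambda>s. B b s \<omega>) t)"
  proof (rule vec_variance_mono)
    show "integrable M (\<lambda>\<omega>. sgd_gradient x y \<alpha> w0 b (\<lambda>s. B b s \<omega>) t)"
      and "integrable M (\<lambda>\<omega>. sgd_gradient x y \<alpha> w0 b' (\<lambda>s. B b' s \<omega>) t)"
      using B B' by (auto intro: integrable_sgd_gradient[where h = "\<lambda>z. z"])
  qed (fact expectation_convex_sgd_gradient[OF B B' b])
  show "vec_variance M
        (\<lambda>\<omega>. grad (full_loss n x y) (sgd_weights x y \<alpha> w0 b' (\<lambda>s. B b' s \<omega>) t))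
      \<le> vec_variance M
        (\<lambda>\<omega>. grad (full_loss n x y) (sgd_weights x y \<alpha> w0 b (\<lambda>s. B b s \<omega>) t))"
  proof (rule vec_variance_mono)
    show "integrable M
        (\<lambda>\<omega>. grad (full_loss n x y) (sgd_weights x y \<alpha> w0 b (\<lambda>s. B b s \<omega>) t))"
      and "integrable M
        (\<lambda>\<omega>. grad (full_loss n x y) (sgd_weights x y \<alpha> w0 b' (\<lambda>s. B b' s \<omega>) t))"
      using B B' by (auto intro: integrable_sgd_weights[where h = "grad (full_loss n x y)"])
  qed (fact expectation_convex_grad_full_loss[OF B B' b])
qed

end
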